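(* Let $r>0$, and let $\{Y_i\}_{i=1}^n$ be i.i.d. random variables with distribution $P_{r,\varepsilon}=(1-\varepsilon)P+\varepsilon G$, where $P\in\mathcal{P}_r=\{\text{distributions }P\text{ on }\mathbb{R}:\ |\mathrm{med}(P)|\le r,\ \mathbb{E}_P\{|X|\}<\infty\}$, $G$ is an arbitrary distribution on $\mathbb{R}$ and $\varepsilon\in(0,1)$. For $\alpha\in(0,1)$, the private stochastic gradient descent estimator $\hat\theta$ defined in the context with constant step size $\eta_i=\alpha r/\sqrt n$, $i=1,\dots,n$, satisfies $$\mathbb{E}_{\{Y_i,W_i\}_{i=1}^n}\big\{R(\hat\theta)-R(\theta(P))\big\}\ \lesssim\ \frac{r}{\sqrt{n\alpha^2}}\ \vee\ \varepsilon r,$$ where $R(t)=\mathbb{E}_{X\sim P}\{|X-t|\}$ and $\theta(P)=\mathrm{med}(P)$.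
   Context: Private SGD: let $\theta_1\in[-r,r]$ be arbitrary and let $W_1,\dots,W_n$ be i.i.d., independent of the data, with $\mathbb{P}\{W_1=1\}=1-\mathbb{P}\{W_1=-1\}=\frac{e^\alpha}{e^\alpha+1}$. Iterate $$\theta_{i+1}=[\theta_i-\eta_iZ_i]_r,\qquad Z_i=\frac{e^\alpha+1}{e^\alpha-1}\,W_i\,s(\theta_i-Y_i),$$ where $[x]_r=\max\{-r,\min\{x,r\}\}$, $s(\theta_i-Y_i)=\mathrm{sign}(\theta_i-Y_i)$ if $\theta_i\ne Y_i$, and $s(\theta_i-Y_i)$ is drawn uniformly from $\{-1,1\}$ (independently of everything else) if $\theta_i=Y_i$; $\eta_i>0$ are step sizes. The estimator is $$\hat\theta=\frac{1}{\sum_{j=1}^n\eta_j}\sum_{i=1}^n\eta_i\theta_i.$$ The excess risk function $R$ is computed under the inlier distribution $P$, with $X\sim P$ independent of the data. $a\vee b=\max(a,b)$; $\lesssim$ denotes inequality up to an absolute multiplicative constant (asymptotically in $n$, where $\alpha,\varepsilon,r$ may depend on $n$). *)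

theory Defs
  imports "HOL-Probability.Probability"
begin

(* Medians need not be unique, so the median is a relation. *)
definition is_median :: "real measure \<Rightarrow> real \<Rightarrow> bool" where
  "is_median P m \<longleftrightarrow> measure P {..m} \<ge> 1/2 \<and> measure P {m..} \<ge> 1/2"

definition risk :: "real measure \<Rightarrow> real \<Rightarrow> real" where
  "risk P t = (LINT x|P. \<bar>x - t\<bar>)"

definition contaminated :: "real \<Rightarrow> real measure \<Rightarrow> real measure \<Rightarrow> real measure" where
  "contaminated \<epsilon> P G = measure_of UNIV (sets borel)
     (\<lambda>A. ennreal (1 - \<epsilon>) * emeasure P A + ennreal \<epsilon> * emeasure G A)"

lemma sets_contaminated [simp, measurable_cong]: "sets (contaminated \<epsilon> P G) = sets borel"
  by (simp add: contaminated_def)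
    (metis sets.sigma_sets_eq space_borel)

lemma space_contaminated [simp]: "space (contaminated \<epsilon> P G) = UNIV"
  by (simp add: contaminated_def)

lemma emeasure_contaminated:
  assumes "sets P = sets borel" "sets G = sets borel" "A \<in> sets borel"
  shows "emeasure (contaminated \<epsilon> P G) A = ennreal (1 - \<epsilon>) * emeasure P A + ennreal \<epsilon> * emeasure G A"
  unfolding contaminated_def
proof (rule emeasure_measure_of_sigma)
  show "sigma_algebra UNIV (sets (borel :: real measure))"
    by (metis sets.sigma_algebra_axioms space_borel)
  show "positive (sets borel) (\<lambda>A. ennreal (1 - \<epsilon>) * emeasure P A + ennreal \<epsilon> * emeasure G A)"
    by (simp add: positive_def)
  show "countably_additive (sets borel) (\<lambda>A. ennreal (1 - \<epsilon>) * emeasure P A + ennreal \<epsilon> * emeasure G A)"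
    unfolding countably_additive_def
  proof (intro allI impI)
    fix F :: "nat \<Rightarrow> real set"
    assume F: "range F \<subseteq> sets borel" "disjoint_family F"
    have "(\<Sum>i. emeasure P (F i)) = emeasure P (\<Union>i. F i)"
      "(\<Sum>i. emeasure G (F i)) = emeasure G (\<Union>i. F i)"
      using F assms by (simp_all add: suminf_emeasure)
    then show "(\<Sum>i. ennreal (1 - \<epsilon>) * emeasure P (F i) + ennreal \<epsilon> * emeasure G (F i)) =
        ennreal (1 - \<epsilon>) * emeasure P (\<Union>i. F i) + ennreal \<epsilon> * emeasure G (\<Union>i. F i)"
      by (simp add: suminf_add[symmetric])
  qed
qed (fact assms)

lemma prob_space_contaminated:
  assumes "real_distribution P" "real_distribution G" "0 \<le> \<epsilon>" "\<epsilon> \<le> 1"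
  shows "prob_space (contaminated \<epsilon> P G)"
proof
  interpret P: real_distribution P by fact
  interpret G: real_distribution G by fact
  show "emeasure (contaminated \<epsilon> P G) (space (contaminated \<epsilon> P G)) = 1"
    using assms(3,4) P.emeasure_space_1 G.emeasure_space_1
    by (simp add: emeasure_contaminated flip: ennreal_plus)
qed

definition random_sign :: "real \<Rightarrow> real pmf" where
  "random_sign p = map_pmf (\<lambda>b. if b then 1 else -1) (bernoulli_pmf p)"

(* A sample point maps an index to (y, w, u): the datum y, the privatizing sign w, and a
   fair sign u that is used only if a tie occurs at that step. The product measure is the
   joint law of the i.i.d. data, the i.i.d. privatizing signs and the tie-breaking signs,
   all of them independent. *)
definition sample_law :: "nat \<Rightarrow> real \<Rightarrow> real measure \<Rightarrow> (nat \<Rightarrow> real \<times> real \<times> real) measure" where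
  "sample_law n \<alpha> Q = PiM {..<n}
     (\<lambda>_. Q \<Otimes>\<^sub>M measure_pmf (random_sign (exp \<alpha> / (exp \<alpha> + 1))) \<Otimes>\<^sub>M measure_pmf (random_sign (1/2)))"

definition clip :: "real \<Rightarrow> real \<Rightarrow> real" where
  "clip r x = max (- r) (min x r)"

definition tie_sgn :: "real \<Rightarrow> real \<Rightarrow> real" where
  "tie_sgn u x = (if x = 0 then u else sgn x)"

definition private_gradient :: "real \<Rightarrow> real \<Rightarrow> real \<times> real \<times> real \<Rightarrow> real" where
  "private_gradient \<alpha> \<theta> = (\<lambda>(y, w, u). (exp \<alpha> + 1) / (exp \<alpha> - 1) * w * tie_sgn u (\<theta> - y))"

(* Indices are shifted to start at 0: iterate i is \<theta>_(i+1). *)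
primrec private_sgd ::
  "real \<Rightarrow> real \<Rightarrow> (nat \<Rightarrow> real) \<Rightarrow> real \<Rightarrow> (nat \<Rightarrow> real \<times> real \<times> real) \<Rightarrow> nat \<Rightarrow> real" where
  "private_sgd r \<alpha> \<eta> \<theta>1 \<omega> 0 = \<theta>1"
| "private_sgd r \<alpha> \<eta> \<theta>1 \<omega> (Suc i) =
     clip r (private_sgd r \<alpha> \<eta> \<theta>1 \<omega> i
       - \<eta> i * private_gradient \<alpha> (private_sgd r \<alpha> \<eta> \<theta>1 \<omega> i) (\<omega> i))"

definition sgd_estimator ::
  "nat \<Rightarrow> real \<Rightarrow> real \<Rightarrow> (nat \<Rightarrow> real) \<Rightarrow> real \<Rightarrow> (nat \<Rightarrow> real \<times> real \<times> real) \<Rightarrow> real" where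
  "sgd_estimator n r \<alpha> \<eta> \<theta>1 \<omega> =
     1 / (\<Sum>j<n. \<eta> j) * (\<Sum>i<n. \<eta> i * private_sgd r \<alpha> \<eta> \<theta>1 \<omega> i)"

end

theory Submission
  imports Defs
begin

text \<open>
  Privatization leaves the mean of the sign unchanged, so the private gradient at \<open>t\<close> has mean
  \<open>Q {..<t} - Q {t<..}\<close> under the contaminated law \<open>Q\<close>. This is linear in \<open>Q\<close>:
  the inlier part is a subgradient of the convex risk, and the outlier part changes the inner
  product with \<open>t - m\<close> by at most \<open>2 * r\<close> times its weight. The usual telescoping of squared distances
  to \<open>m\<close> along projected steps whose gradient has constant magnitude then bounds the average excess
  risk of the iterates, hence by convexity that of the averaged iterate.
\<close>

section \<open>Mean signs under the contaminated law\<close>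

lemma sgn_eq_indicator_diff:
  "sgn (t - y) = indicator {..<t} y - indicator {t<..} (y :: real)"
  by (auto simp: sgn_if indicator_def)

lemma integral_sgn_diff:
  assumes "prob_space M" and [measurable_cong]: "sets M = sets borel"
  shows "(LINT y|M. sgn (t - y)) = measure M {..<t} - measure M {t<..}"
proof -
  interpret prob_space M by fact
  have [simp]: "space M = UNIV"
    using sets_eq_imp_space_eq[OF assms(2)] by simp
  show ?thesis
    unfolding sgn_eq_indicator_diff
    by (subst Bochner_Integration.integral_diff) (auto simp: assms(2) emeasure_eq_measure)
qed

lemma measure_contaminated:
  assumes "real_distribution P" "real_distribution G" "0 \<le> \<epsilon>" "\<epsilon> \<le> 1" "A \<in> sets borel"
  shows "measure (contaminated \<epsilon> P G) A = (1 - \<epsilon>) * measure P A + \<epsilon> * measure G A"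
proof -
  interpret P: real_distribution P by fact
  interpret G: real_distribution G by fact
  have "emeasure (contaminated \<epsilon> P G) A = ennreal ((1 - \<epsilon>) * measure P A + \<epsilon> * measure G A)"
    using assms(3-5) by (simp add: emeasure_contaminated P.emeasure_eq_measure G.emeasure_eq_measure
        ennreal_mult ennreal_plus)
  then show ?thesis
    using assms(3,4) by (intro measure_eq_emeasure_eq_ennreal) simp_all
qed

text \<open>Each mean sign is a difference of measures of two open half-lines, so linearity in the
  law is needed only for the measure of sets, not for integrals of general functions.\<close>

lemma integral_sgn_contaminated:
  assumes "real_distribution P" "real_distribution G" "0 \<le> \<epsilon>" "\<epsilon> \<le> 1"
  shows "(LINT y|contaminated \<epsilon> P G. sgn (t - y)) =
    (1 - \<epsilon>) * (LINT y|P. sgn (t - y)) + \<epsilon> * (LINT y|G. sgn (t - y))"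
proof -
  interpret P: real_distribution P by fact
  interpret G: real_distribution G by fact
  interpret Q: prob_space "contaminated \<epsilon> P G" by (rule prob_space_contaminated) fact+
  show ?thesis
    using assms
    by (simp add: integral_sgn_diff P.prob_space_axioms G.prob_space_axioms Q.prob_space_axioms measure_contaminated algebra_simps)
qed

section \<open>The absolute-error risk: Lipschitz bound, subgradients, convexity\<close>

text \<open>The reverse triangle inequality under the integral. It later serves three ends:
  measurability of the risk, boundedness of the excess risk on [-r, r], and the cost of replacing
  the weight 1 - \<epsilon> of the inliers by 1.\<close>

lemma risk_diff_le_dist:
  assumes "real_distribution P" "integrable P (\<lambda>x. \<bar>x\<bar>)"
  shows "\<bar>risk P s - risk P t\<bar> \<le> \<bar>s - t\<bar>"
proof -
  interpret P: real_distribution P by fact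
  have i: "integrable P (\<lambda>x. \<bar>x - a\<bar>)" for a
    using assms(2) by (intro integrable_abs Bochner_Integration.integrable_diff) (auto simp: integrable_abs_iff)
  have "risk P s - risk P t = (LINT x|P. \<bar>x - s\<bar> - \<bar>x - t\<bar>)"
    by (simp add: risk_def i)
  also have "\<bar>\<dots>\<bar> \<le> (LINT x|P. \<bar>\<bar>x - s\<bar> - \<bar>x - t\<bar>\<bar>)"
    by (rule integral_abs_bound)
  also have "\<dots> \<le> (LINT x|P. \<bar>s - t\<bar>)"
    by (intro integral_mono integrable_abs Bochner_Integration.integrable_diff i) auto
  finally show ?thesis using P.prob_space by simp
qed

text \<open>Pointwise, \<open>sgn (t - y)\<close> is a subgradient of the distance to
  \<open>y\<close> at \<open>t\<close>; at a tie the value 0 is one of the admissible slopes in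
  [-1, 1]. Integrating over \<open>P\<close> keeps the inequality.\<close>

lemma risk_subgradient:
  assumes "real_distribution P" "integrable P (\<lambda>x. \<bar>x\<bar>)"
  shows "risk P t - risk P m \<le> (t - m) * (LINT y|P. sgn (t - y))"
proof -
  interpret P: real_distribution P by fact
  have i: "integrable P (\<lambda>x. \<bar>x - a\<bar>)" for a
    using assms(2) by (intro integrable_abs Bochner_Integration.integrable_diff) (auto simp: integrable_abs_iff)
  have j: "integrable P (\<lambda>y. sgn (t - y))"
    by (rule P.integrable_const_bound[where B = 1]) (auto simp: sgn_if)
  have "risk P t - risk P m = (LINT x|P. \<bar>x - t\<bar> - \<bar>x - m\<bar>)"
    by (simp add: risk_def i)
  also have "\<dots> \<le> (LINT x|P. (t - m) * sgn (t - x))"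
    using i j by (intro integral_mono Bochner_Integration.integrable_diff) (auto simp: sgn_if)
  finally show ?thesis using j by simp
qed

text \<open>Jensen's inequality for finitely many weights. For the absolute value it is just the
  triangle inequality, once \<open>x\<close> is written as its own weighted average.\<close>

lemma risk_weighted_average_le:
  assumes "real_distribution P" "integrable P (\<lambda>x. \<bar>x\<bar>)"
    and "finite I" "\<And>i. i \<in> I \<Longrightarrow> 0 \<le> a i" "(\<Sum>i\<in>I. a i) = 1"
  shows "risk P (\<Sum>i\<in>I. a i * t i) \<le> (\<Sum>i\<in>I. a i * risk P (t i))"
proof -
  interpret P: real_distribution P by fact
  have i: "integrable P (\<lambda>x. \<bar>x - b\<bar>)" for b
    using assms(2) by (intro integrable_abs Bochner_Integration.integrable_diff) (auto simp: integrable_abs_iff)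
  have le: "\<bar>x - (\<Sum>i\<in>I. a i * t i)\<bar> \<le> (\<Sum>i\<in>I. a i * \<bar>x - t i\<bar>)" for x
  proof -
    have "x - (\<Sum>i\<in>I. a i * t i) = (\<Sum>i\<in>I. a i * x) - (\<Sum>i\<in>I. a i * t i)"
      by (simp add: assms(5) flip: sum_distrib_right)
    also have "\<dots> = (\<Sum>i\<in>I. a i * (x - t i))"
      by (simp add: right_diff_distrib sum_subtractf)
    also have "\<bar>\<dots>\<bar> \<le> (\<Sum>i\<in>I. \<bar>a i * (x - t i)\<bar>)" by (rule sum_abs)
    also have "\<dots> = (\<Sum>i\<in>I. a i * \<bar>x - t i\<bar>)"
      using assms(4) by (simp add: abs_mult)
    finally show ?thesis .
  qed
  have "risk P (\<Sum>i\<in>I. a i * t i) \<le> (LINT x|P. (\<Sum>i\<in>I. a i * \<bar>x - t i\<bar>))"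
    unfolding risk_def using i le by (intro integral_mono) auto
  also have "\<dots> = (\<Sum>i\<in>I. a i * risk P (t i))"
    by (simp add: risk_def i)
  finally show ?thesis .
qed

lemma borel_measurable_risk:
  assumes "real_distribution P" "integrable P (\<lambda>x. \<bar>x\<bar>)"
  shows "risk P \<in> borel_measurable borel"
proof -
  have "1-lipschitz_on UNIV (risk P)"
    using risk_diff_le_dist[OF assms] by (intro lipschitz_onI) (auto simp: dist_real_def)
  then show ?thesis
    by (intro borel_measurable_continuous_onI lipschitz_on_continuous_on)
qed

section \<open>The private gradient at a fixed point: measurability, magnitude, mean\<close>

lemma integral_random_sign:
  assumes "p \<in> {0..1}"
  shows "(LINT w|measure_pmf (random_sign p). f w) = p * f 1 + (1 - p) * (f (-1) :: real)"
  using assms by (simp add: random_sign_def algebra_simps)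

abbreviation step_law :: "real \<Rightarrow> real measure \<Rightarrow> (real \<times> real \<times> real) measure" where
  "step_law \<alpha> Q \<equiv>
    Q \<Otimes>\<^sub>M measure_pmf (random_sign (exp \<alpha> / (exp \<alpha> + 1))) \<Otimes>\<^sub>M measure_pmf (random_sign (1/2))"

lemma prob_space_step_law: "prob_space Q \<Longrightarrow> prob_space (step_law \<alpha> Q)"
  by (intro prob_space_pair prob_space_measure_pmf)

text \<open>Measurability holds jointly in the point and the sample because the gradient is later
  evaluated at an iterate, which is itself random.\<close>

lemma borel_measurable_private_gradient [measurable]:
  assumes [measurable_cong]: "sets Q = sets borel"
  shows "(\<lambda>(t, z). private_gradient \<alpha> t z) \<in> borel_measurable (borel \<Otimes>\<^sub>M step_law \<alpha> Q)"
proof -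
  have [measurable]: "(\<lambda>w. w) \<in> measure_pmf p \<rightarrow>\<^sub>M (borel :: real measure)" for p by simp
  show ?thesis unfolding private_gradient_def tie_sgn_def by measurable
qed

lemma AE_pair_random_sign:
  "AE (w, u) in measure_pmf (random_sign p) \<Otimes>\<^sub>M measure_pmf (random_sign q). \<bar>w\<bar> = 1 \<and> \<bar>u\<bar> = 1"
proof -
  interpret pair_prob_space "measure_pmf (random_sign p)" "measure_pmf (random_sign q)" ..
  have [measurable]: "(\<lambda>w. w) \<in> measure_pmf s \<rightarrow>\<^sub>M (borel :: real measure)" for s by simp
  have "AE w in random_sign p. AE u in random_sign q. \<bar>w\<bar> = 1 \<and> \<bar>u\<bar> = 1"
    by (auto simp: AE_measure_pmf_iff random_sign_def)
  then show ?thesis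
    by (intro AE_pair_measure) (simp_all add: case_prod_beta)
qed

lemma abs_private_gradient:
  "\<bar>w\<bar> = 1 \<Longrightarrow> \<bar>u\<bar> = 1 \<Longrightarrow> \<bar>private_gradient \<alpha> t (y, w, u)\<bar> = \<bar>(exp \<alpha> + 1) / (exp \<alpha> - 1)\<bar>"
  by (simp add: private_gradient_def tie_sgn_def abs_mult abs_sgn_eq)

text \<open>The exceptional set consists of samples whose signs are not 1 or -1 and does not depend
  on \<open>t\<close>. Hence the quantifier over \<open>t\<close> can stand inside, which allows
  \<open>t\<close> to be a random iterate.\<close>

lemma AE_abs_private_gradient:
  assumes "prob_space Q" and [measurable_cong]: "sets Q = sets borel"
  shows "AE z in step_law \<alpha> Q. \<forall>t. \<bar>private_gradient \<alpha> t z\<bar> = \<bar>(exp \<alpha> + 1) / (exp \<alpha> - 1)\<bar>"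
proof -
  interpret Q: prob_space Q by fact
  let ?W = "measure_pmf (random_sign (exp \<alpha> / (exp \<alpha> + 1)))" and ?U = "measure_pmf (random_sign (1/2))"
  interpret WU: pair_prob_space ?W ?U ..
  interpret QWU: pair_prob_space Q "?W \<Otimes>\<^sub>M ?U" ..
  have [measurable]: "(\<lambda>w. w) \<in> measure_pmf p \<rightarrow>\<^sub>M (borel :: real measure)" for p by simp
  have "AE z in step_law \<alpha> Q. \<bar>fst (snd z)\<bar> = 1 \<and> \<bar>snd (snd z)\<bar> = 1"
    using AE_pair_random_sign
    by (intro QWU.AE_pair_measure) (simp_all add: case_prod_beta)
  then show ?thesis
    by eventually_elim (use abs_private_gradient in \<open>metis prod.collapse\<close>)
qed

lemma integrable_private_gradient:
  assumes "prob_space Q" and [measurable_cong]: "sets Q = sets borel"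
  shows "integrable (step_law \<alpha> Q) (private_gradient \<alpha> t)"
proof -
  interpret prob_space "step_law \<alpha> Q" by (rule prob_space_step_law) fact
  have "(\<lambda>z. private_gradient \<alpha> t z) \<in> borel_measurable (step_law \<alpha> Q)"
    by measurable
  moreover have "AE z in step_law \<alpha> Q. norm (private_gradient \<alpha> t z) \<le> \<bar>(exp \<alpha> + 1) / (exp \<alpha> - 1)\<bar>"
    using AE_abs_private_gradient[OF assms] by eventually_elim simp
  ultimately show ?thesis by (intro integrable_const_bound)
qed

text \<open>The factor in front of the privatizing sign is the reciprocal of the mean of that sign.\<close>

lemma integral_private_gradient:
  assumes "prob_space Q" "sets Q = sets borel" "\<alpha> \<noteq> 0"
  shows "(LINT z|step_law \<alpha> Q. private_gradient \<alpha> t z) = (LINT y|Q. sgn (t - y))"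
proof -
  interpret Q: prob_space Q by fact
  let ?p = "exp \<alpha> / (exp \<alpha> + 1)"
  let ?W = "measure_pmf (random_sign ?p)" and ?U = "measure_pmf (random_sign (1/2))"
  interpret WU: pair_prob_space ?W ?U ..
  interpret QWU: pair_prob_space Q "?W \<Otimes>\<^sub>M ?U" ..
  have p: "?p \<in> {0..1}" by (simp add: field_simps add_pos_pos)
  have cp: "(exp \<alpha> + 1) / (exp \<alpha> - 1) * (2 * ?p - 1) = 1"
  proof -
    have "exp \<alpha> + 1 \<noteq> 0" using exp_gt_zero[of \<alpha>] by linarith
    moreover have "exp \<alpha> - 1 \<noteq> 0" using assms(3) by simp
    moreover have "2 * ?p - 1 = (exp \<alpha> - 1) / (exp \<alpha> + 1)"
      using calculation(1) by (simp add: field_simps)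
    ultimately show ?thesis by simp
  qed
  have "(LINT z|step_law \<alpha> Q. private_gradient \<alpha> t z) =
      (LINT y|Q. LINT wu|(?W \<Otimes>\<^sub>M ?U). private_gradient \<alpha> t (y, wu))"
    by (rule QWU.integral_fst'[symmetric]) (rule integrable_private_gradient; fact)
  also have "\<dots> = (LINT y|Q. sgn (t - y))"
  proof (rule Bochner_Integration.integral_cong[OF refl])
    fix y
    \<comment> \<open>Joint integrability gives integrable slices only for almost every
      \<open>y\<close>, while the congruence is proved at every \<open>y\<close>.\<close>
    have "integrable (?W \<Otimes>\<^sub>M ?U) (\<lambda>wu. private_gradient \<alpha> t (y, wu))"
      (is "integrable ?M ?f")
    proof (rule WU.P.integrable_const_bound)
      have [measurable]: "(\<lambda>w. w) \<in> measure_pmf p \<rightarrow>\<^sub>M (borel :: real measure)" for p by simp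
      show "?f \<in> borel_measurable ?M"
        unfolding private_gradient_def tie_sgn_def by measurable
      show "AE wu in ?M. norm (?f wu) \<le> \<bar>(exp \<alpha> + 1) / (exp \<alpha> - 1)\<bar>"
        using AE_pair_random_sign by eventually_elim (auto simp: abs_private_gradient)
    qed
    then have "(LINT wu|(?W \<Otimes>\<^sub>M ?U). private_gradient \<alpha> t (y, wu)) =
        (LINT w|?W. LINT u|?U. private_gradient \<alpha> t (y, w, u))"
      by (rule WU.integral_fst'[symmetric])
    also have "\<dots> = (exp \<alpha> + 1) / (exp \<alpha> - 1) * (2 * ?p - 1) * sgn (t - y)"
    proof -
      have eq: "p * (K * 1 * s) + (1 - p) * (K * (- 1) * s) = K * (2 * p - 1) * s" for p K s :: real
        by (simp add: algebra_simps)
      \<comment> \<open>The fair tie-breaking sign has mean 0, which is the value of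
        \<open>sgn\<close> at 0, so averaging over \<open>u\<close> turns \<open>tie_sgn\<close>
        into \<open>sgn\<close>.\<close>
      have "(LINT u|?U. private_gradient \<alpha> t (y, w, u)) = (exp \<alpha> + 1) / (exp \<alpha> - 1) * w * sgn (t - y)" for w
        by (simp add: private_gradient_def) (simp add: integral_random_sign tie_sgn_def)
      then show ?thesis
        by (simp only: integral_random_sign[OF p]) (rule eq)
    qed
    finally show "(LINT wu|(?W \<Otimes>\<^sub>M ?U). private_gradient \<alpha> t (y, wu)) = sgn (t - y)"
      by (simp only: cp mult_1)
  qed
  finally show ?thesis .
qed

section \<open>One-step inequality under contamination\<close>

text \<open>The factor 2 has two sources, each costing \<epsilon> times the distance from
  \<open>t\<close> to \<open>m\<close>: the outliers can push the mean sign the wrong way, and the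
  inlier part supplies only the fraction 1 - \<epsilon> of the risk difference.\<close>

lemma risk_diff_le_expected_gradient:
  assumes P: "real_distribution P" "integrable P (\<lambda>x. \<bar>x\<bar>)" and G: "real_distribution G"
    and "0 \<le> \<epsilon>" "\<epsilon> \<le> 1" "\<alpha> \<noteq> 0"
  shows "risk P t - risk P m \<le>
    (LINT z|step_law \<alpha> (contaminated \<epsilon> P G). private_gradient \<alpha> t z * (t - m)) + 2 * \<epsilon> * \<bar>t - m\<bar>"
proof -
  interpret G: real_distribution G by fact
  let ?g = "\<lambda>M. LINT y|M. sgn (t - y)"
  have "\<bar>?g G\<bar> \<le> (LINT y|G. \<bar>sgn (t - y)\<bar>)"
    by (rule integral_abs_bound)
  also have "\<dots> \<le> (LINT y|G. 1)"
    by (intro integral_mono integrable_abs G.integrable_const_bound[where B = 1]) (auto simp: abs_sgn_eq)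
  finally have "\<bar>?g G\<bar> \<le> 1" using G.prob_space by simp
  then have g: "- \<bar>t - m\<bar> \<le> (t - m) * ?g G"
    using mult_left_le[of "\<bar>?g G\<bar>" "\<bar>t - m\<bar>"] abs_ge_minus_self[of "(t - m) * ?g G"] by (simp add: abs_mult)
  have D: "risk P t - risk P m \<le> \<bar>t - m\<bar>"
    using risk_diff_le_dist[OF P, of t m] by linarith
  have "(LINT z|step_law \<alpha> (contaminated \<epsilon> P G). private_gradient \<alpha> t z * (t - m)) =
      (t - m) * ?g (contaminated \<epsilon> P G)"
    using prob_space_contaminated[OF P(1) G] assms(4-)
    by (simp add: integral_private_gradient)
  also have "\<dots> = (1 - \<epsilon>) * ((t - m) * ?g P) + \<epsilon> * ((t - m) * ?g G)"
    using assms by (simp add: integral_sgn_contaminated algebra_simps)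
  also have "\<dots> \<ge> (1 - \<epsilon>) * (risk P t - risk P m) + \<epsilon> * (- \<bar>t - m\<bar>)"
    using assms g risk_subgradient[OF P] by (intro add_mono mult_left_mono) auto
  also have "(1 - \<epsilon>) * (risk P t - risk P m) = (risk P t - risk P m) - \<epsilon> * (risk P t - risk P m)"
    by (simp add: algebra_simps)
  finally show ?thesis
    using mult_left_mono[OF D \<open>0 \<le> \<epsilon>\<close>] by linarith
qed

text \<open>Fubini with one coordinate singled out. It replaces conditioning on the past: all other
  coordinates are frozen and only the fresh sample is averaged.\<close>

lemma (in product_prob_space) integral_PiM_nonneg_coordinate:
  fixes f :: "_ \<Rightarrow> real"
  assumes "finite I" "i \<in> I" "integrable (Pi\<^sub>M I M) f"
    and "\<And>x. 0 \<le> (LINT y|M i. f (x(i := y)))"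
  shows "0 \<le> integral\<^sup>L (Pi\<^sub>M I M) f"
proof -
  have "integral\<^sup>L (Pi\<^sub>M (insert i (I - {i})) M) f =
      (LINT x|Pi\<^sub>M (I - {i}) M. LINT y|M i. f (x(i := y)))"
    using assms(1-3) by (intro product_integral_insert) (auto simp: insert_absorb)
  then show ?thesis
    using assms(2,4) by (simp add: insert_absorb)
qed

section \<open>Paths of the projected iteration\<close>

lemma abs_clip_le: "0 \<le> r \<Longrightarrow> \<bar>clip r x\<bar> \<le> r"
  by (auto simp: clip_def)

text \<open>Projection onto [-r, r] never moves a point away from a point of that interval.\<close>

lemma clip_dist_sq_le: "\<bar>m\<bar> \<le> r \<Longrightarrow> (clip r x - m)\<^sup>2 \<le> (x - m)\<^sup>2"
  by (auto simp: clip_def simp flip: abs_le_square_iff)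

lemma private_sgd_bounded: "\<bar>\<theta>\<bar> \<le> r \<Longrightarrow> \<bar>private_sgd r \<alpha> \<eta> \<theta> \<omega> i\<bar> \<le> r"
  by (cases i) (auto intro: abs_clip_le)

text \<open>Iterate \<open>i\<close> reads only coordinates below \<open>i\<close>. This is the form
  in which independence of an iterate from the sample used at its own step enters.\<close>

lemma private_sgd_fun_upd: "i \<le> j \<Longrightarrow> private_sgd r \<alpha> \<eta> \<theta> (x(j := z)) i = private_sgd r \<alpha> \<eta> \<theta> x i"
  by (induction i) auto

text \<open>A statement about a single path, without expectations. Each step expands the square
  after dropping the projection; the quadratic term is exactly
  \<open>c\<^sup>2 * (\<eta> i)\<^sup>2\<close>, and the squared distances to \<open>m\<close>
  telescope. The final distance is kept on the left for the induction.\<close>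

lemma private_sgd_regret:
  assumes "\<bar>m\<bar> \<le> r" and "\<And>i t. i < n \<Longrightarrow> \<bar>private_gradient \<alpha> t (\<omega> i)\<bar> = \<bar>c\<bar>"
  shows "(private_sgd r \<alpha> \<eta> \<theta> \<omega> n - m)\<^sup>2 +
      2 * (\<Sum>i<n. \<eta> i * (private_gradient \<alpha> (private_sgd r \<alpha> \<eta> \<theta> \<omega> i) (\<omega> i) * (private_sgd r \<alpha> \<eta> \<theta> \<omega> i - m)))
    \<le> (\<theta> - m)\<^sup>2 + c\<^sup>2 * (\<Sum>i<n. (\<eta> i)\<^sup>2)"
  using assms(2)
proof (induction n)
  case 0
  show ?case by simp
next
  case (Suc n)
  define t where "t = private_sgd r \<alpha> \<eta> \<theta> \<omega> n"
  define g where "g = private_gradient \<alpha> t (\<omega> n)"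
  have g: "g\<^sup>2 = c\<^sup>2" using Suc.prems[of n t] by (metis g_def lessI power2_abs)
  have "(private_sgd r \<alpha> \<eta> \<theta> \<omega> (Suc n) - m)\<^sup>2 \<le> (t - \<eta> n * g - m)\<^sup>2"
    using clip_dist_sq_le[OF assms(1)] by (simp add: t_def g_def)
  also have "\<dots> = (t - m)\<^sup>2 - 2 * (\<eta> n * (g * (t - m))) + g\<^sup>2 * (\<eta> n)\<^sup>2"
    by (simp add: power2_eq_square algebra_simps)
  finally show ?case
    using Suc.IH Suc.prems unfolding g by (simp add: algebra_simps flip: t_def g_def)
qed

lemma measurable_private_sgd:
  assumes "sets Q = sets borel" "i \<le> n"
  shows "(\<lambda>\<omega>. private_sgd r \<alpha> \<eta> \<theta> \<omega> i) \<in> borel_measurable (Pi\<^sub>M {..<n} (\<lambda>_. step_law \<alpha> Q))"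
  using assms(2)
proof (induction i)
  case 0
  show ?case by simp
next
  case (Suc i)
  note [measurable] = borel_measurable_private_gradient[OF assms(1)]
  have [measurable]: "(\<lambda>\<omega>. private_sgd r \<alpha> \<eta> \<theta> \<omega> i) \<in> borel_measurable (Pi\<^sub>M {..<n} (\<lambda>_. step_law \<alpha> Q))"
    "(\<lambda>\<omega>. \<omega> i) \<in> Pi\<^sub>M {..<n} (\<lambda>_. step_law \<alpha> Q) \<rightarrow>\<^sub>M step_law \<alpha> Q"
    using Suc by (auto intro: measurable_component_singleton)
  show ?case by (simp add: clip_def)
qed

section \<open>Expected excess risk for arbitrary positive step sizes\<close>

text \<open>All iterates and \<open>m\<close> lie in [-r, r], so their distance is at most 2r. This
  gives \<open>4 * r\<^sup>2\<close> for the initial squared distance and turns the contamination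
  term of the one-step inequality into \<open>4 * \<epsilon> * r\<close>.\<close>

theorem sgd_excess_risk:
  fixes \<eta> :: "nat \<Rightarrow> real"
  assumes P: "real_distribution P" "integrable P (\<lambda>x. \<bar>x\<bar>)" and G: "real_distribution G"
    and \<epsilon>: "0 \<le> \<epsilon>" "\<epsilon> \<le> 1" and \<alpha>: "\<alpha> \<noteq> 0" and m: "\<bar>m\<bar> \<le> r" and \<theta>: "\<bar>\<theta>\<bar> \<le> r"
    and n: "n \<ge> 1" and \<eta>: "\<And>i. \<eta> i > 0"
  shows "(LINT \<omega>|sample_law n \<alpha> (contaminated \<epsilon> P G).
      risk P (sgd_estimator n r \<alpha> \<eta> \<theta> \<omega>) - risk P m)
    \<le> (4 * r\<^sup>2 + ((exp \<alpha> + 1) / (exp \<alpha> - 1))\<^sup>2 * (\<Sum>i<n. (\<eta> i)\<^sup>2)) / (2 * (\<Sum>i<n. \<eta> i)) + 4 * \<epsilon> * r"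
proof -
  define c where "c = (exp \<alpha> + 1) / (exp \<alpha> - 1)"
  define Q where "Q = contaminated \<epsilon> P G"
  define N where "N = step_law \<alpha> Q"
  define M where "M = Pi\<^sub>M {..<n} (\<lambda>_. N)"
  define th where "th i \<omega> = private_sgd r \<alpha> \<eta> \<theta> \<omega> i" for i \<omega>
  define g where "g i \<omega> = private_gradient \<alpha> (th i \<omega>) (\<omega> i)" for i \<omega>
  define est where "est = sgd_estimator n r \<alpha> \<eta> \<theta>"
  define D where "D t = risk P t - risk P m" for t
  define S where "S = (\<Sum>i<n. \<eta> i)"
  have S: "S > 0" unfolding S_def using n \<eta> by (intro sum_pos) (auto simp: lessThan_empty_iff)
  interpret Q: prob_space Q unfolding Q_def by (rule prob_space_contaminated) fact+
  have [measurable_cong]: "sets Q = sets borel" by (simp add: Q_def)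
  interpret N: prob_space N unfolding N_def by (rule prob_space_step_law) unfold_locales
  interpret PN: product_prob_space "\<lambda>_. N" "{..<n}" ..
  interpret M: prob_space M unfolding M_def by (rule prob_space_PiM) unfold_locales
  have th_bound: "\<bar>th i \<omega>\<bar> \<le> r" for i \<omega>
    unfolding th_def by (rule private_sgd_bounded[OF \<theta>])
  have th_dist: "\<bar>th i \<omega> - m\<bar> \<le> 2 * r" for i \<omega>
    using th_bound[of i \<omega>] m by linarith
  have [measurable]: "risk P \<in> borel_measurable borel" by (rule borel_measurable_risk[OF P])
  then have [measurable]: "D \<in> borel_measurable borel" unfolding D_def by measurable
  have D_le: "\<bar>D t\<bar> \<le> \<bar>t - m\<bar>" for t
    unfolding D_def by (rule risk_diff_le_dist[OF P])
  have th_meas: "th i \<in> borel_measurable M" if "i < n" for i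
    unfolding th_def M_def N_def using that by (intro measurable_private_sgd) (simp_all add: Q_def)
  have g_meas: "g i \<in> borel_measurable M" if "i < n" for i
  proof -
    have "(\<lambda>\<omega>. \<omega> i) \<in> M \<rightarrow>\<^sub>M step_law \<alpha> Q"
      unfolding M_def N_def by (rule measurable_component_singleton) (simp add: that)
    then have "(\<lambda>\<omega>. (\<lambda>(t, z). private_gradient \<alpha> t z) (th i \<omega>, \<omega> i)) \<in> borel_measurable M"
      by (intro measurable_compose[OF measurable_Pair borel_measurable_private_gradient[of Q]]
          th_meas[OF that]) (simp_all add: Q_def)
    then show ?thesis by (simp add: g_def[abs_def])
  qed
  have "AE z in N. \<forall>t. \<bar>private_gradient \<alpha> t z\<bar> = \<bar>c\<bar>"
    unfolding N_def c_def by (rule AE_abs_private_gradient) (unfold_locales, simp add: Q_def)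
  then have "AE \<omega> in M. \<forall>t. \<bar>private_gradient \<alpha> t (\<omega> i)\<bar> = \<bar>c\<bar>" if "i < n" for i
    unfolding M_def using that N.prob_space_axioms
    by (intro AE_PiM_component[where P = "\<lambda>z. \<forall>t. \<bar>private_gradient \<alpha> t z\<bar> = \<bar>c\<bar>"]) auto
  then have pg: "AE \<omega> in M. \<forall>i<n. \<forall>t. \<bar>private_gradient \<alpha> t (\<omega> i)\<bar> = \<bar>c\<bar>"
    by (simp add: AE_all_countable)
  have g_int: "integrable M (\<lambda>\<omega>. g i \<omega> * (th i \<omega> - m))" if "i < n" for i
  proof (rule M.integrable_const_bound)
    show "AE \<omega> in M. norm (g i \<omega> * (th i \<omega> - m)) \<le> \<bar>c\<bar> * (2 * r)"
      using pg by eventually_elim (use that th_dist in \<open>auto simp: g_def abs_mult intro: mult_left_mono\<close>)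
    show "(\<lambda>\<omega>. g i \<omega> * (th i \<omega> - m)) \<in> borel_measurable M"
      using th_meas[OF that] g_meas[OF that] by measurable
  qed
  have D_int: "integrable M (\<lambda>\<omega>. D (th i \<omega>))" if "i < n" for i
  proof (rule M.integrable_const_bound)
    show "AE \<omega> in M. norm (D (th i \<omega>)) \<le> 2 * r"
      using order_trans[OF D_le th_dist] by simp
    show "(\<lambda>\<omega>. D (th i \<omega>)) \<in> borel_measurable M"
      using th_meas[OF that] by measurable
  qed
  have step: "(LINT \<omega>|M. D (th i \<omega>)) \<le> (LINT \<omega>|M. g i \<omega> * (th i \<omega> - m)) + 4 * \<epsilon> * r" if "i < n" for i
  proof -
    \<comment> \<open>The inequality is put as one nonnegative integral so that coordinate
      \<open>i\<close> can be integrated first. With the others frozen, the iterate is a constant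
      \<open>t\<close> and the one-step inequality applies.\<close>
    have "0 \<le> (LINT \<omega>|M. g i \<omega> * (th i \<omega> - m) + 4 * \<epsilon> * r - D (th i \<omega>))"
      unfolding M_def
    proof (rule PN.integral_PiM_nonneg_coordinate[where i = i])
      show "integrable (Pi\<^sub>M {..<n} (\<lambda>_. N)) (\<lambda>\<omega>. g i \<omega> * (th i \<omega> - m) + 4 * \<epsilon> * r - D (th i \<omega>))"
        using g_int[OF that] D_int[OF that] M.finite_measure_axioms
        by (auto simp flip: M_def)
      fix x
      define t where "t = th i x"
      have upd: "th i (x(i := z)) = t" "g i (x(i := z)) = private_gradient \<alpha> t z" for z
        by (simp_all add: g_def th_def t_def private_sgd_fun_upd)
      have "\<epsilon> * \<bar>t - m\<bar> \<le> \<epsilon> * (2 * r)"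
        unfolding t_def by (intro mult_left_mono th_dist \<epsilon>)
      then have "D t \<le> (LINT z|N. private_gradient \<alpha> t z * (t - m)) + 4 * \<epsilon> * r"
        using risk_diff_le_expected_gradient[OF P G \<epsilon> \<alpha>, of t m] by (simp add: D_def N_def Q_def)
      moreover have "integrable N (\<lambda>z. private_gradient \<alpha> t z * (t - m))"
        unfolding N_def by (intro integrable_mult_left integrable_private_gradient) (unfold_locales, simp add: Q_def)
      ultimately show "0 \<le> (LINT z|N. g i (x(i := z)) * (th i (x(i := z)) - m) + 4 * \<epsilon> * r - D (th i (x(i := z))))"
        using N.prob_space by (simp add: upd)
    qed (use that in auto)
    then show ?thesis
      using g_int[OF that] D_int[OF that] M.prob_space by simp
  qed
  have "AE \<omega> in M. (\<Sum>i<n. \<eta> i * (g i \<omega> * (th i \<omega> - m))) \<le> (4 * r\<^sup>2 + c\<^sup>2 * (\<Sum>i<n. (\<eta> i)\<^sup>2)) / 2"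
    using pg
  proof eventually_elim
    case (elim \<omega>)
    \<comment> \<open>Drops the final squared distance and replaces the initial one by its
      bound.\<close>
    have lin: "y \<le> (d + b) / 2" if "x + 2 * y \<le> a + b" "0 \<le> x" "a \<le> d" for a b d x y :: real
      using that by (simp add: field_simps)
    have "(\<theta> - m)\<^sup>2 \<le> (2 * r)\<^sup>2"
      using \<theta> m by (intro abs_le_square_iff[THEN iffD1]) linarith
    then have start: "(\<theta> - m)\<^sup>2 \<le> 4 * r\<^sup>2" by (simp add: power_mult_distrib)
    have "(th n \<omega> - m)\<^sup>2 + 2 * (\<Sum>i<n. \<eta> i * (g i \<omega> * (th i \<omega> - m)))
        \<le> (\<theta> - m)\<^sup>2 + c\<^sup>2 * (\<Sum>i<n. (\<eta> i)\<^sup>2)"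
      unfolding g_def th_def using elim by (intro private_sgd_regret[OF m]) auto
    from lin[OF this _ start] show ?case by simp
  qed
  then have "(LINT \<omega>|M. (\<Sum>i<n. \<eta> i * (g i \<omega> * (th i \<omega> - m)))) \<le>
      (LINT \<omega>|M. (4 * r\<^sup>2 + c\<^sup>2 * (\<Sum>i<n. (\<eta> i)\<^sup>2)) / 2)"
    using g_int by (intro integral_mono_AE) auto
  then have regret: "(\<Sum>i<n. \<eta> i * (LINT \<omega>|M. g i \<omega> * (th i \<omega> - m)))
      \<le> (4 * r\<^sup>2 + c\<^sup>2 * (\<Sum>i<n. (\<eta> i)\<^sup>2)) / 2"
    using g_int M.prob_space by simp
  \<comment> \<open>The weights \<open>\<eta> i / S\<close> are nonnegative and sum to 1, so the
    estimator is a convex combination of the iterates; this yields both its bound by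
    \<open>r\<close> and the use of Jensen's inequality.\<close>
  have est_eq: "est \<omega> = (\<Sum>i<n. \<eta> i / S * th i \<omega>)" for \<omega>
    by (simp add: est_def sgd_estimator_def S_def th_def sum_divide_distrib)
  have weights: "(\<Sum>i<n. \<eta> i / S) = 1"
    using S by (simp add: S_def flip: sum_divide_distrib)
  have est_bound: "\<bar>est \<omega>\<bar> \<le> r" for \<omega>
  proof -
    have "\<bar>est \<omega>\<bar> \<le> (\<Sum>i<n. \<bar>\<eta> i / S * th i \<omega>\<bar>)"
      unfolding est_eq by (rule sum_abs)
    also have "\<dots> \<le> (\<Sum>i<n. \<eta> i / S * r)"
      using S \<eta> th_bound by (intro sum_mono) (auto simp: abs_mult less_imp_le intro!: mult_mono divide_right_mono)
    also have "\<dots> = r"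
      unfolding sum_distrib_right[symmetric] weights by simp
    finally show ?thesis .
  qed
  \<comment> \<open>A Bochner integral defaults to 0 without integrability; here the integrand is
    bounded, so the left-hand side of the claim is a genuine expectation.\<close>
  have est_int: "integrable M (\<lambda>\<omega>. D (est \<omega>))"
  proof (rule M.integrable_const_bound)
    have "norm (D (est \<omega>)) \<le> 2 * r" for \<omega>
      using D_le[of "est \<omega>"] est_bound[of \<omega>] m by simp
    then show "AE \<omega> in M. norm (D (est \<omega>)) \<le> 2 * r" by simp
    have "est \<in> borel_measurable M"
      unfolding est_eq[abs_def] using th_meas by (intro borel_measurable_sum borel_measurable_times) auto
    then show "(\<lambda>\<omega>. D (est \<omega>)) \<in> borel_measurable M" by measurable
  qed
  have D_est: "D (est \<omega>) \<le> (\<Sum>i<n. \<eta> i / S * D (th i \<omega>))" for \<omega>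
  proof -
    have "risk P (est \<omega>) \<le> (\<Sum>i<n. \<eta> i / S * risk P (th i \<omega>))"
      unfolding est_eq using S \<eta> weights
      by (intro risk_weighted_average_le[OF P]) (auto simp: less_imp_le)
    moreover have "(\<Sum>i<n. \<eta> i / S * D (th i \<omega>)) =
        (\<Sum>i<n. \<eta> i / S * risk P (th i \<omega>)) - (\<Sum>i<n. \<eta> i / S) * risk P m"
      by (simp add: D_def right_diff_distrib sum_subtractf sum_distrib_right)
    ultimately show ?thesis by (simp add: D_def weights)
  qed
  have "(LINT \<omega>|M. D (est \<omega>)) \<le> (LINT \<omega>|M. (\<Sum>i<n. \<eta> i / S * D (th i \<omega>)))"
    using est_int D_int D_est by (intro integral_mono) auto
  also have "\<dots> = (\<Sum>i<n. \<eta> i / S * (LINT \<omega>|M. D (th i \<omega>)))"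
    using D_int by simp
  also have "\<dots> \<le> (\<Sum>i<n. \<eta> i / S * ((LINT \<omega>|M. g i \<omega> * (th i \<omega> - m)) + 4 * \<epsilon> * r))"
    using step S \<eta> by (intro sum_mono mult_left_mono) (auto simp: less_imp_le)
  also have "\<dots> = (\<Sum>i<n. \<eta> i * (LINT \<omega>|M. g i \<omega> * (th i \<omega> - m))) / S + (\<Sum>i<n. \<eta> i / S) * (4 * \<epsilon> * r)"
    by (simp add: distrib_left sum.distrib sum_divide_distrib sum_distrib_right)
  also have "\<dots> \<le> (4 * r\<^sup>2 + c\<^sup>2 * (\<Sum>i<n. (\<eta> i)\<^sup>2)) / 2 / S + 4 * \<epsilon> * r"
    using divide_right_mono[OF regret, of S] S by (simp add: weights)
  finally show ?thesis
    by (simp add: D_def est_def sample_law_def c_def S_def flip: Q_def N_def M_def)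
qed

section \<open>Constant step size and explicit constants\<close>

text \<open>The denominator is at least \<alpha>, and the numerator is at most 4 because e is at
  most 3. So the gradient magnitude is of order 1/\<alpha>, the price of privacy.\<close>

lemma exp_ratio_bounds:
  assumes "\<alpha> \<in> {0<..<1::real}"
  shows "0 \<le> (exp \<alpha> + 1) / (exp \<alpha> - 1)" "(exp \<alpha> + 1) / (exp \<alpha> - 1) \<le> 4 / \<alpha>"
proof -
  have e: "\<alpha> \<le> exp \<alpha> - 1" using exp_ge_add_one_self[of \<alpha>] by linarith
  show "0 \<le> (exp \<alpha> + 1) / (exp \<alpha> - 1)" using e assms by simp
  have "exp \<alpha> \<le> 3"
    using assms exp_le order_trans[of "exp \<alpha>" "exp 1" 3] by simp
  then show "(exp \<alpha> + 1) / (exp \<alpha> - 1) \<le> 4 / \<alpha>"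
    using e assms by (intro frac_le) auto
qed

theorem proposition20:
  shows "\<exists>C::real. C > 0 \<and>
    (\<forall>(n::nat) (r::real) (\<alpha>::real) (\<epsilon>::real) (\<theta>1::real) (P::real measure) (G::real measure) (m::real).
       n \<ge> 1 \<longrightarrow> r > 0 \<longrightarrow> \<alpha> \<in> {0<..<1} \<longrightarrow> \<epsilon> \<in> {0<..<1} \<longrightarrow> \<theta>1 \<in> {-r..r} \<longrightarrow>
       real_distribution P \<longrightarrow> integrable P (\<lambda>x. \<bar>x\<bar>) \<longrightarrow> is_median P m \<longrightarrow> \<bar>m\<bar> \<le> r \<longrightarrow>
       real_distribution G \<longrightarrow>
       (LINT \<omega>|sample_law n \<alpha> (contaminated \<epsilon> P G).
          risk P (sgd_estimator n r \<alpha> (\<lambda>_. \<alpha> * r / sqrt n) \<theta>1 \<omega>) - risk P m)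
       \<le> C * max (r / sqrt (n * \<alpha>\<^sup>2)) (\<epsilon> * r))"
\<comment> \<open>The witness is 14 = 2 + 8 + 4. In units of
  \<open>r / sqrt (n * \<alpha>\<^sup>2)\<close>, the initial distance contributes 2 and the squared
  gradients 8; contamination contributes 4 in units of \<open>\<epsilon> * r\<close>. Each unit is
  at most the maximum.\<close>
proof (intro exI[of _ 14] conjI allI impI)
  fix n :: nat and r \<alpha> \<epsilon> \<theta>1 m :: real and P G :: "real measure"
  assume n: "n \<ge> 1" and r: "r > 0" and \<alpha>: "\<alpha> \<in> {0<..<1}" and \<epsilon>: "\<epsilon> \<in> {0<..<1}" and \<theta>: "\<theta>1 \<in> {-r..r}"
    and P: "real_distribution P" "integrable P (\<lambda>x. \<bar>x\<bar>)" and m: "\<bar>m\<bar> \<le> r" and G: "real_distribution G"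
  define c where "c = (exp \<alpha> + 1) / (exp \<alpha> - 1)"
  define q where "q = sqrt n"
  define \<eta> where "\<eta> = \<alpha> * r / q"
  have q: "q > 0" "q\<^sup>2 = n" using n by (simp_all add: q_def)
  have \<eta>: "\<eta> > 0" using q r \<alpha> by (simp add: \<eta>_def)
  have c: "c\<^sup>2 \<le> (4 / \<alpha>)\<^sup>2"
    using exp_ratio_bounds[OF \<alpha>] unfolding c_def by (intro power_mono)
  have "(LINT \<omega>|sample_law n \<alpha> (contaminated \<epsilon> P G).
        risk P (sgd_estimator n r \<alpha> (\<lambda>_. \<eta>) \<theta>1 \<omega>) - risk P m)
      \<le> (4 * r\<^sup>2 + c\<^sup>2 * (\<Sum>i<n. \<eta>\<^sup>2)) / (2 * (\<Sum>i<n. \<eta>)) + 4 * \<epsilon> * r"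
    unfolding c_def using \<alpha> \<epsilon> \<theta> \<eta> n by (intro sgd_excess_risk[OF P G _ _ _ m]) auto
  also have "(4 * r\<^sup>2 + c\<^sup>2 * (\<Sum>i<n. \<eta>\<^sup>2)) / (2 * (\<Sum>i<n. \<eta>)) = 2 * r\<^sup>2 / (q\<^sup>2 * \<eta>) + c\<^sup>2 * \<eta> / 2"
    using \<eta> n q by (simp add: power2_eq_square field_simps)
  also have "\<dots> \<le> 2 * r\<^sup>2 / (q\<^sup>2 * \<eta>) + (4 / \<alpha>)\<^sup>2 * \<eta> / 2"
    using c \<eta> by (intro add_left_mono divide_right_mono mult_right_mono) auto
  also have "\<dots> = 10 * (r / (q * \<alpha>))"
    using q(1) r \<alpha> unfolding \<eta>_def by (simp add: power2_eq_square field_simps)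
  also have "q * \<alpha> = sqrt (n * \<alpha>\<^sup>2)"
    using \<alpha> by (simp add: q_def real_sqrt_mult)
  also have "10 * (r / sqrt (n * \<alpha>\<^sup>2)) + 4 * \<epsilon> * r \<le> 14 * max (r / sqrt (n * \<alpha>\<^sup>2)) (\<epsilon> * r)"
    by (simp add: max_def)
  finally show "(LINT \<omega>|sample_law n \<alpha> (contaminated \<epsilon> P G).
        risk P (sgd_estimator n r \<alpha> (\<lambda>_. \<alpha> * r / sqrt n) \<theta>1 \<omega>) - risk P m)
      \<le> 14 * max (r / sqrt (n * \<alpha>\<^sup>2)) (\<epsilon> * r)"
    by (simp add: \<eta>_def q_def)
qed simp

end
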